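(* Let $G$ be an $n$-cell weighted network and $\mathcal P$ a standard partition of its set of cells. The partition $\mathcal P$ is exo-balanced for $G$ if and only if, for every choice of total phase space $(\mathbb{R}^k)^n$ ($k\ge1$), $\Delta_{\mathcal P}$ is left invariant under the flow of every system in $I_{G,0}$.
   Context: A weighted network $G$ with set of cells $C=\{1,\ldots,n\}$ is a directed graph with real edge weights. Its adjacency matrix is $W_G=[w_{ij}]\in\mathbb{R}^{n\times n}$, where $w_{ij}$ is the weight of the edge from cell $j$ to cell $i$ (zero if there is no such edge; self-loops allowed). The Laplacian matrix is $L_G=D_G-W_G$, where $D_G$ is the diagonal matrix whose $i$-th diagonal entry is the input valency $v(i)=\sum_{j\in C}w_{ij}$. A standard partition $\mathcal P=\{P_1,\ldots,P_p\}$ of $C$ is an ordinary partition into disjoint nonempty parts. With cell phase space $\mathbb{R}^k$, the associated polydiagonal is $\Delta_{\mathcal P}=\{x\in(\mathbb{R}^k)^n: x_i=x_j$ whenever $i,j$ are in the same part$\}$. The standard partition $\mathcal P$ is exo-balanced if $\Delta_{\mathcal P}\subseteq\mathbb{R}^n$ (case $k=1$) satisfies $L_G\Delta_{\mathcal P}\subseteq\Delta_{\mathcal P}$; that is, for any $i,i'$ in the same part and every part $P\in\mathcal P$ not containing $i$, $\sum_{j\in P}w_{ij}=\sum_{j\in P}w_{i'j}$. Coupled cell systems with additive input structure: for $k\ge1$, $I_G$ is the set of systems $\dot x=f(x)$ on $(\mathbb{R}^k)^n$ of the form $\dot x_j=g(x_j)+\sum_{i=1}^n w_{ji}h(x_j,x_i)$,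 $j=1,\ldots,n$, with $g:\mathbb{R}^k\to\mathbb{R}^k$ and $h:\mathbb{R}^k\times\mathbb{R}^k\to\mathbb{R}^k$ smooth. $I_{G,0}\subseteq I_G$ is the subset of those with $h(x,x)=0$ for all $x$. A subspace $\Delta$ is left invariant under the flow of a system if every solution with initial condition in $\Delta$ remains in $\Delta$ on its interval of existence. *)

theory Defs
  imports "HOL-Analysis.Analysis" "HOL-Library.Disjoint_Sets"
begin

section \<open>Weighted networks, polydiagonals and exo-balanced partitions\<close>

text \<open>The set of cells is the finite type \<open>'n\<close>. A weighted network is given by its adjacency matrix
  \<open>W\<close>, where \<open>W $ i $ j\<close> is the weight of the edge from cell \<open>j\<close> to cell \<open>i\<close>, and \<open>0\<close> if there is
  no such edge.\<close>

type_synonym 'n network = "real^'n^'n"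

definition input_valency :: "'n::finite network \<Rightarrow> 'n \<Rightarrow> real" where
  "input_valency W i = (\<Sum>j\<in>UNIV. W $ i $ j)"

definition laplacian :: "'n::finite network \<Rightarrow> real^'n^'n" where
  "laplacian W = (\<chi> i j. if i = j then input_valency W i else 0) - W"

text \<open>The first argument \<open>X\<close> is the phase space of a single cell. It is a set rather than a type,
  since the dimension of the cell phase space is quantified inside the theorem.\<close>

definition polydiagonal :: "'a set \<Rightarrow> 'n::finite set set \<Rightarrow> ('a^'n) set" where
  "polydiagonal X \<P> = {x. (\<forall>i. x $ i \<in> X) \<and> (\<forall>A\<in>\<P>. \<forall>i\<in>A. \<forall>j\<in>A. x $ i = x $ j)}"

lemma polydiagonalD:
  "\<lbrakk>x \<in> polydiagonal X \<P>; A \<in> \<P>; i \<in> A; j \<in> A\<rbrakk> \<Longrightarrow> x $ i = x $ j"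
  unfolding polydiagonal_def by blast

definition exo_balanced :: "'n::finite network \<Rightarrow> 'n set set \<Rightarrow> bool" where
  "exo_balanced W \<P> \<longleftrightarrow>
     (\<lambda>x. laplacian W *v x) ` polydiagonal (UNIV :: real set) \<P> \<subseteq> polydiagonal UNIV \<P>"

lemma laplacian_mult_nth:
  "(laplacian W *v x) $ i = (\<Sum>j\<in>UNIV. W $ i $ j * (x $ i - x $ j))"
proof -
  have "(laplacian W *v x) $ i =
      (\<Sum>j\<in>UNIV. (if i = j then input_valency W i * x $ i else 0) - W $ i $ j * x $ j)"
    unfolding matrix_vector_mult_def laplacian_def
    by simp (intro sum.cong refl, simp add: left_diff_distrib)
  also have "\<dots> = input_valency W i * x $ i - (\<Sum>j\<in>UNIV. W $ i $ j * x $ j)"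
    by (simp add: sum_subtractf)
  also have "\<dots> = (\<Sum>j\<in>UNIV. W $ i $ j * (x $ i - x $ j))"
    by (simp add: input_valency_def sum_distrib_right right_diff_distrib sum_subtractf)
  finally show ?thesis .
qed

lemma exo_balanced_iff:
  fixes W :: "'n::finite network"
  assumes P: "partition_on UNIV \<P>"
  shows "exo_balanced W \<P> \<longleftrightarrow>
    (\<forall>A\<in>\<P>. \<forall>i\<in>A. \<forall>i'\<in>A. \<forall>B\<in>\<P>. i \<notin> B \<longrightarrow>
       (\<Sum>j\<in>B. W $ i $ j) = (\<Sum>j\<in>B. W $ i' $ j))" (is "_ \<longleftrightarrow> ?R")
proof
  assume E: "exo_balanced W \<P>"
  show ?R
  proof (intro ballI impI)
    fix A i i' B assume A: "A \<in> \<P>" "i \<in> A" "i' \<in> A" and B: "B \<in> \<P>" "i \<notin> B"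
    have dj: "A' \<inter> B = {}" if "A' \<in> \<P>" "A' \<noteq> B" for A'
      using that B P by (auto simp: partition_on_def disjoint_def)
    define x :: "real^'n" where "x = (\<chi> j. if j \<in> B then 1 else 0)"
    have "x \<in> polydiagonal UNIV \<P>"
      using dj by (auto simp: polydiagonal_def x_def)
    then have "laplacian W *v x \<in> polydiagonal UNIV \<P>"
      using E unfolding exo_balanced_def by blast
    then have "(laplacian W *v x) $ i = (laplacian W *v x) $ i'"
      using A by (rule polydiagonalD)
    moreover have "(laplacian W *v x) $ l = - (\<Sum>j\<in>B. W $ l $ j)" if "l \<notin> B" for l
    proof -
      have "(laplacian W *v x) $ l = (\<Sum>j\<in>UNIV. if j \<in> B then - W $ l $ j else 0)"
        unfolding laplacian_mult_nth x_def using that by (intro sum.cong refl) simp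
      then show ?thesis by (simp add: sum.If_cases sum_negf)
    qed
    moreover have "i' \<notin> B" using dj A B by blast
    ultimately show "(\<Sum>j\<in>B. W $ i $ j) = (\<Sum>j\<in>B. W $ i' $ j)"
      using B by simp
  qed
next
  assume R: ?R
  have split: "(\<Sum>j\<in>UNIV. f j) = (\<Sum>B\<in>\<P>. \<Sum>j\<in>B. f j)" for f :: "'n \<Rightarrow> real"
  proof -
    have "sum f (\<Union>\<P>) = (\<Sum>B\<in>\<P>. sum f B)"
      using P by (subst sum.Union_disjoint) (auto simp: partition_on_def disjoint_def)
    then show ?thesis using P by (simp add: partition_on_def)
  qed
  have *: "(laplacian W *v x) $ i = (laplacian W *v x) $ i'"
    if x: "x \<in> polydiagonal UNIV \<P>" and A: "A \<in> \<P>" "i \<in> A" "i' \<in> A" for x A i i'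
    unfolding laplacian_mult_nth split
  proof (rule sum.cong[OF refl])
    fix B assume B: "B \<in> \<P>"
    have eq: "x $ j = x $ l" if "j \<in> B" "l \<in> B" for j l
      using polydiagonalD[OF x B that] .
    have ii: "x $ i = x $ i'" using polydiagonalD[OF x A] .
    show "(\<Sum>j\<in>B. W $ i $ j * (x $ i - x $ j)) = (\<Sum>j\<in>B. W $ i' $ j * (x $ i' - x $ j))"
    proof (cases "i \<in> B")
      case True
      then have "x $ i - x $ j = 0" "x $ i' - x $ j = 0" if "j \<in> B" for j
        using eq[OF that True] ii by simp_all
      then show ?thesis by simp
    next
      case False
      obtain b where b: "b \<in> B" using P B unfolding partition_on_def by (metis equals0I)
      have c: "(\<Sum>j\<in>B. W $ l $ j * (x $ l - x $ j)) = (\<Sum>j\<in>B. W $ l $ j) * (x $ l - x $ b)" for l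
        unfolding sum_distrib_right by (intro sum.cong refl) (use eq b in metis)
      have "(\<Sum>j\<in>B. W $ i $ j) = (\<Sum>j\<in>B. W $ i' $ j)" using R A B False by blast
      then show ?thesis using ii unfolding c by simp
    qed
  qed
  have "laplacian W *v x \<in> polydiagonal UNIV \<P>" if "x \<in> polydiagonal UNIV \<P>" for x
    by (subst polydiagonal_def, rule CollectI, intro conjI allI ballI UNIV_I) (rule *[OF that])
  then show "exo_balanced W \<P>"
    unfolding exo_balanced_def by (rule image_subsetI)
qed

section \<open>Smooth maps\<close>

text \<open>The space of real vectors indexed by the set \<open>I\<close>; in particular \<open>rvec {..<k}\<close> is the space of
  real \<open>k\<close>-vectors. Functions extended by \<open>0\<close> are used instead of a type, so that \<open>k\<close> can be
  quantified. For finite \<open>I\<close> the product topology restricted to \<open>rvec I\<close> is the Euclidean one.\<close>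

definition rvec :: "'i set \<Rightarrow> ('i \<Rightarrow> real) set" where
  "rvec I = {x. \<forall>i. i \<notin> I \<longrightarrow> x i = 0}"

text \<open>Real functions of class \<open>C\<^sup>m\<close> on \<open>rvec I\<close> for finite \<open>I\<close>: all iterated partial derivatives up to
  order \<open>m\<close> exist and are continuous.\<close>

primrec C_diff :: "nat \<Rightarrow> 'i set \<Rightarrow> (('i \<Rightarrow> real) \<Rightarrow> real) \<Rightarrow> bool" where
  "C_diff 0 I f \<longleftrightarrow> continuous_on (rvec I) f"
| "C_diff (Suc m) I f \<longleftrightarrow> continuous_on (rvec I) f \<and>
     (\<forall>i\<in>I. \<exists>f'. C_diff m I f' \<and>
        (\<forall>x\<in>rvec I. ((\<lambda>s. f (x(i := s))) has_real_derivative f' x) (at (x i))))"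

definition smooth_map :: "'i set \<Rightarrow> 'j set \<Rightarrow> (('i \<Rightarrow> real) \<Rightarrow> ('j \<Rightarrow> real)) \<Rightarrow> bool" where
  "smooth_map I J f \<longleftrightarrow>
     (\<forall>x\<in>rvec I. f x \<in> rvec J) \<and> (\<forall>j\<in>J. \<forall>m. C_diff m I (\<lambda>x. f x j))"

text \<open>Smoothness of a map of two variables. The product of two copies of \<open>rvec {..<k}\<close> is
  identified with the vectors indexed by the disjoint sum \<open>{..<k} <+> {..<k}\<close>.\<close>

definition smooth_map2 :: "nat \<Rightarrow> ((nat \<Rightarrow> real) \<Rightarrow> (nat \<Rightarrow> real) \<Rightarrow> (nat \<Rightarrow> real)) \<Rightarrow> bool" where
  "smooth_map2 k h \<longleftrightarrow>
     smooth_map ({..<k} <+> {..<k}) {..<k} (\<lambda>z. h (z \<circ> Inl) (z \<circ> Inr))"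

section \<open>Coupled cell systems with additive input structure\<close>

definition phase_space :: "nat \<Rightarrow> ((nat \<Rightarrow> real)^'n::finite) set" where
  "phase_space k = {x. \<forall>i. x $ i \<in> rvec {..<k}}"

definition admissible ::
  "nat \<Rightarrow> 'n::finite network \<Rightarrow> ((nat \<Rightarrow> real) \<Rightarrow> (nat \<Rightarrow> real)) \<Rightarrow>
   ((nat \<Rightarrow> real) \<Rightarrow> (nat \<Rightarrow> real) \<Rightarrow> (nat \<Rightarrow> real)) \<Rightarrow>
   ((nat \<Rightarrow> real)^'n \<Rightarrow> (nat \<Rightarrow> real)^'n) \<Rightarrow> bool" where
  "admissible k W g h f \<longleftrightarrow>
     smooth_map {..<k} {..<k} g \<and> smooth_map2 k h \<and>
     (\<forall>x\<in>phase_space k. \<forall>j.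
        f x $ j = (\<lambda>c. g (x $ j) c + (\<Sum>i\<in>UNIV. W $ j $ i * h (x $ j) (x $ i) c)))"

text \<open>A system is identified with its vector field, whose values outside \<open>phase_space k\<close> are
  irrelevant.\<close>

definition systems_I ::
  "nat \<Rightarrow> 'n::finite network \<Rightarrow> ((nat \<Rightarrow> real)^'n \<Rightarrow> (nat \<Rightarrow> real)^'n) set" where
  "systems_I k W = {f. \<exists>g h. admissible k W g h f}"

definition systems_I0 ::
  "nat \<Rightarrow> 'n::finite network \<Rightarrow> ((nat \<Rightarrow> real)^'n \<Rightarrow> (nat \<Rightarrow> real)^'n) set" where
  "systems_I0 k W = {f. \<exists>g h. admissible k W g h f \<and> (\<forall>x\<in>rvec {..<k}. h x x = (\<lambda>_. 0))}"

lemma systems_I0_subset: "systems_I0 k W \<subseteq> systems_I k W"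
  by (auto simp: systems_I0_def systems_I_def)

section \<open>Solutions and flow-invariance\<close>

definition solution_on ::
  "nat \<Rightarrow> ((nat \<Rightarrow> real)^'n \<Rightarrow> (nat \<Rightarrow> real)^'n::finite) \<Rightarrow> real set \<Rightarrow>
   (real \<Rightarrow> (nat \<Rightarrow> real)^'n) \<Rightarrow> bool" where
  "solution_on k f T x \<longleftrightarrow>
     (\<forall>t\<in>T. x t \<in> phase_space k \<and>
        (\<forall>i. \<forall>c<k. ((\<lambda>s. (x s $ i) c) has_real_derivative (f (x t) $ i) c) (at t)))"

text \<open>Every solution on an open interval around the initial time is the restriction of a maximal
  solution, so it is equivalent to quantify over all such intervals or over the maximal interval of
  existence only. As the systems are autonomous, the initial time is \<open>0\<close>.\<close>

definition flow_invariant ::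
  "nat \<Rightarrow> ((nat \<Rightarrow> real)^'n \<Rightarrow> (nat \<Rightarrow> real)^'n::finite) \<Rightarrow> ((nat \<Rightarrow> real)^'n) set \<Rightarrow> bool" where
  "flow_invariant k f \<Delta> \<longleftrightarrow>
     (\<forall>T x. open T \<and> is_interval T \<and> 0 \<in> T \<and> solution_on k f T x \<and> x 0 \<in> \<Delta>
        \<longrightarrow> (\<forall>t\<in>T. x t \<in> \<Delta>))"

end

theory Submission imports Defs begin

text \<open>If \<open>\<P>\<close> is exo-balanced, the vector field of a system in \<open>I\<^sub>G\<^sub>,\<^sub>0\<close> is tangent to the
  polydiagonal: for \<open>x\<close> in the polydiagonal and a cell \<open>j\<close>, the vector with entries \<open>h (x\<^sub>j, x\<^sub>l)\<close> is
  constant on the parts and vanishes on the part of \<open>j\<close>, so the coupling term of \<open>j\<close> is minus its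
  image under the Laplacian. Since the vector field is locally Lipschitz, a Gronwall estimate for
  the squared distance between a solution and its projection to the polydiagonal yields invariance.
  Conversely, \<open>h (x, y) = y - x\<close> on one-dimensional cells gives the linear system with matrix
  \<open>- L\<^sub>G\<close>, and an invariant subspace of a linear system is invariant under its matrix.\<close>

section \<open>Lipschitz estimates\<close>

definition cube :: "'i set \<Rightarrow> real \<Rightarrow> ('i \<Rightarrow> real) set" where
  "cube I R = {x \<in> rvec I. \<forall>i\<in>I. \<bar>x i\<bar> \<le> R}"

text \<open>Tychonoff's theorem: the cube is the full product of the intervals
  \<open>{-R..R}\<close> over \<open>I\<close> and of \<open>{0}\<close> at all other
  indices.\<close>

lemma compact_cube: "compact (cube I R)"
proof -
  have "cube I R = PiE UNIV (\<lambda>i. if i \<in> I then {-R..R} else {0})"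
    by (intro set_eqI) (simp add: cube_def rvec_def PiE_iff abs_le_iff minus_le_iff, metis)
  moreover have "compactin (product_topology (\<lambda>i. euclidean) UNIV)
      (PiE UNIV (\<lambda>i. if i \<in> I then {-R..R} else {0::real}))"
    by (auto simp: compactin_PiE)
  ultimately show ?thesis
    by (simp add: euclidean_product_topology)
qed

text \<open>The partial derivatives are continuous, hence bounded on the compact cube. The mean
  value inequality is applied to one coordinate at a time; the path from \<open>x\<close> to
  \<open>y\<close> that changes one coordinate after another stays inside the cube.\<close>

lemma C_diff_lipschitz_on_cube:
  assumes "finite I" and f: "C_diff (Suc 0) I f"
  shows "\<exists>L\<ge>0. \<forall>x\<in>cube I R. \<forall>y\<in>cube I R. \<bar>f x - f y\<bar> \<le> L * (\<Sum>i\<in>I. \<bar>x i - y i\<bar>)"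
proof -
  have "\<exists>f' B. (\<forall>x\<in>cube I R. \<bar>f' x\<bar> \<le> B) \<and>
      (\<forall>x\<in>rvec I. ((\<lambda>s. f (x(i := s))) has_real_derivative f' x) (at (x i)))" if i: "i \<in> I" for i
  proof -
    obtain f' where c: "continuous_on (rvec I) f'"
      and d: "\<forall>x\<in>rvec I. ((\<lambda>s. f (x(i := s))) has_real_derivative f' x) (at (x i))"
      using f i by auto
    have "compact (f' ` cube I R)"
      by (rule compact_continuous_image[OF continuous_on_subset[OF c] compact_cube])
        (auto simp: cube_def)
    then obtain B where "\<forall>y\<in>f' ` cube I R. norm y \<le> B"
      using compact_imp_bounded bounded_iff by blast
    then show ?thesis using d by auto
  qed
  then obtain f' B where B: "\<And>i x. \<lbrakk>i \<in> I; x \<in> cube I R\<rbrakk> \<Longrightarrow> \<bar>f' i x\<bar> \<le> B i"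
    and d: "\<And>i x. \<lbrakk>i \<in> I; x \<in> rvec I\<rbrakk> \<Longrightarrow>
      ((\<lambda>s. f (x(i := s))) has_real_derivative f' i x) (at (x i))"
    by metis
  \<comment> \<open>The sum dominates every single bound and is nonnegative even if some
    \<open>B i\<close> is not.\<close>
  define L where "L = (\<Sum>i\<in>I. \<bar>B i\<bar>)"
  have BL: "B i \<le> L" if "i \<in> I" for i
    using member_le_sum[OF that, of "\<lambda>i. \<bar>B i\<bar>"] \<open>finite I\<close> by (simp add: L_def)
  have L0: "L \<ge> 0" by (simp add: L_def sum_nonneg)
  \<comment> \<open>\<open>J\<close> contains the coordinates in which \<open>x\<close> and
    \<open>y\<close> may differ. In the induction step \<open>x\<close> is replaced by
    \<open>z\<close>, which has one more coordinate in common with \<open>y\<close>, so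
    \<open>x\<close> has to be arbitrary.\<close>
  have "finite J \<Longrightarrow> J \<subseteq> I \<Longrightarrow> x \<in> cube I R \<Longrightarrow> y \<in> cube I R \<Longrightarrow> (\<forall>i. i \<notin> J \<longrightarrow> x i = y i) \<Longrightarrow>
      \<bar>f x - f y\<bar> \<le> L * (\<Sum>i\<in>J. \<bar>x i - y i\<bar>)" for J x y
  proof (induction J arbitrary: x rule: finite_induct)
    case empty
    then have "x = y" by auto
    then show ?case by simp
  next
    case (insert i J)
    define z where "z = x(i := y i)"
    have i: "i \<in> I" using insert.prems by simp
    have upd: "x(i := s) \<in> cube I R" if "s \<in> {-R..R}" for s
      using insert.prems(2) that i by (auto simp: cube_def rvec_def abs_le_iff)
    have xi: "x i \<in> {-R..R}" "y i \<in> {-R..R}"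
      using insert.prems(2,3) i by (auto simp: cube_def abs_le_iff)
    have "norm (f (x(i := x i)) - f (x(i := y i))) \<le> L * norm (x i - y i)"
    proof (rule field_differentiable_bound[where S = "{-R..R}"])
      fix s assume s: "s \<in> {-R..R}"
      have "x(i := s) \<in> rvec I" using upd[OF s] by (simp add: cube_def)
      from d[OF i this] show "((\<lambda>s. f (x(i := s))) has_field_derivative f' i (x(i := s)))
          (at s within {-R..R})"
        by (simp add: has_field_derivative_at_within)
      show "norm (f' i (x(i := s))) \<le> L"
        using B[OF i upd[OF s]] BL[OF i] by simp
    qed (use xi in auto)
    then have 1: "\<bar>f x - f z\<bar> \<le> L * \<bar>x i - y i\<bar>" by (simp add: z_def)
    have "\<bar>f z - f y\<bar> \<le> L * (\<Sum>j\<in>J. \<bar>z j - y j\<bar>)"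
    proof (rule insert.IH)
      show "z \<in> cube I R" unfolding z_def by (rule upd[OF xi(2)])
    qed (use insert.prems in \<open>auto simp: z_def\<close>)
    moreover have "(\<Sum>j\<in>J. \<bar>z j - y j\<bar>) = (\<Sum>j\<in>J. \<bar>x j - y j\<bar>)"
      using insert.hyps by (intro sum.cong) (auto simp: z_def)
    ultimately have "\<bar>f z - f y\<bar> \<le> L * (\<Sum>j\<in>J. \<bar>x j - y j\<bar>)" by simp
    then have "\<bar>f x - f y\<bar> \<le> L * \<bar>x i - y i\<bar> + L * (\<Sum>j\<in>J. \<bar>x j - y j\<bar>)"
      using 1 by linarith
    then show ?case using insert.hyps by (simp add: distrib_left)
  qed
  \<comment> \<open>With \<open>J = I\<close> the agreement outside \<open>J\<close> is automatic:
    points of the cube vanish there.\<close>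
  from this[OF \<open>finite I\<close> order.refl] show ?thesis
    using L0 by (intro exI[of _ L]) (auto simp: cube_def rvec_def)
qed

section \<open>Algebra of real functions that are Lipschitz for a given distance\<close>

definition lipschitz_wrt :: "('a \<Rightarrow> 'a \<Rightarrow> real) \<Rightarrow> 'a set \<Rightarrow> ('a \<Rightarrow> real) \<Rightarrow> bool" where
  "lipschitz_wrt d S F \<longleftrightarrow> (\<exists>L. \<forall>x\<in>S. \<forall>y\<in>S. \<bar>F x - F y\<bar> \<le> L * d x y)"

lemma lipschitz_wrt_add:
  assumes "lipschitz_wrt d S F" "lipschitz_wrt d S G"
  shows "lipschitz_wrt d S (\<lambda>x. F x + G x)"
proof -
  obtain L M where "\<forall>x\<in>S. \<forall>y\<in>S. \<bar>F x - F y\<bar> \<le> L * d x y" "\<forall>x\<in>S. \<forall>y\<in>S. \<bar>G x - G y\<bar> \<le> M * d x y"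
    using assms unfolding lipschitz_wrt_def by blast
  then have "\<bar>(F x + G x) - (F y + G y)\<bar> \<le> (L + M) * d x y" if "x \<in> S" "y \<in> S" for x y
    unfolding distrib_right using that by (smt (verit))
  then show ?thesis unfolding lipschitz_wrt_def by blast
qed

lemma lipschitz_wrt_cmult:
  assumes "lipschitz_wrt d S F"
  shows "lipschitz_wrt d S (\<lambda>x. a * F x)"
proof -
  obtain L where L: "\<forall>x\<in>S. \<forall>y\<in>S. \<bar>F x - F y\<bar> \<le> L * d x y"
    using assms unfolding lipschitz_wrt_def by blast
  have "\<bar>a * F x - a * F y\<bar> \<le> (\<bar>a\<bar> * L) * d x y" if "x \<in> S" "y \<in> S" for x y
    using mult_left_mono[of "\<bar>F x - F y\<bar>" "L * d x y" "\<bar>a\<bar>"] L that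
    by (simp add: abs_mult mult.assoc flip: right_diff_distrib)
  then show ?thesis unfolding lipschitz_wrt_def by blast
qed

lemma lipschitz_wrt_sum:
  assumes "\<And>i. i \<in> A \<Longrightarrow> lipschitz_wrt d S (F i)"
  shows "lipschitz_wrt d S (\<lambda>x. \<Sum>i\<in>A. F i x)"
  using assms
proof (induction A rule: infinite_finite_induct)
  case (insert a A)
  then show ?case by (simp add: lipschitz_wrt_add)
\<comment> \<open>Over an infinite or empty index set the sum is the constant 0, so the constant 0
  serves as Lipschitz constant.\<close>
qed (auto simp: lipschitz_wrt_def intro: exI[of _ 0])

text \<open>The l1 distance of states, to match the form of the bound in
  \<open>C_diff_lipschitz_on_cube\<close>.\<close>

definition state_dist :: "nat \<Rightarrow> (nat \<Rightarrow> real)^'n::finite \<Rightarrow> (nat \<Rightarrow> real)^'n \<Rightarrow> real" where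
  "state_dist k x y = (\<Sum>(i, c)\<in>UNIV \<times> {..<k}. \<bar>(x $ i) c - (y $ i) c\<bar>)"

definition state_cube :: "nat \<Rightarrow> real \<Rightarrow> ((nat \<Rightarrow> real)^'n::finite) set" where
  "state_cube k R = {x. \<forall>i. x $ i \<in> cube {..<k} R}"

lemma sum_cell_le_state_dist: "(\<Sum>c<k. \<bar>(x $ i) c - (y $ i) c\<bar>) \<le> state_dist k x y"
  unfolding state_dist_def sum.cartesian_product[symmetric]
  by (rule member_le_sum[where f = "\<lambda>i. \<Sum>c<k. \<bar>(x $ i) c - (y $ i) c\<bar>"]) (auto intro: sum_nonneg)

text \<open>The components of \<open>g\<close> and \<open>h\<close> are of class
  \<open>C\<^sup>1\<close>, hence Lipschitz on cubes, and each component of the vector field is a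
  linear combination of such functions of cell states.\<close>

lemma admissible_lipschitz:
  fixes f :: "(nat \<Rightarrow> real)^'n::finite \<Rightarrow> (nat \<Rightarrow> real)^'n"
  assumes adm: "admissible k W g h f" and c: "c < k"
  shows "lipschitz_wrt (state_dist k) (state_cube k R) (\<lambda>x. (f x $ j) c)"
proof -
  have G: "lipschitz_wrt (state_dist k) (state_cube k R) (\<lambda>x::(nat \<Rightarrow> real)^'n. g (x $ j) c)"
  proof -
    have "C_diff (Suc 0) {..<k} (\<lambda>x. g x c)"
      using adm c unfolding admissible_def smooth_map_def by blast
    from C_diff_lipschitz_on_cube[OF finite_lessThan this, of R]
    obtain L where "L \<ge> 0" and L: "\<And>x y. \<lbrakk>x \<in> cube {..<k} R; y \<in> cube {..<k} R\<rbrakk> \<Longrightarrow>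
        \<bar>g x c - g y c\<bar> \<le> L * (\<Sum>i<k. \<bar>x i - y i\<bar>)" by blast
    have "\<bar>g (x $ j) c - g (y $ j) c\<bar> \<le> L * state_dist k x y"
      if "x \<in> state_cube k R" "y \<in> state_cube k R" for x y :: "(nat \<Rightarrow> real)^'n"
      using L[of "x $ j" "y $ j"] that
        mult_left_mono[OF sum_cell_le_state_dist[of x j y k] \<open>L \<ge> 0\<close>]
      by (simp add: state_cube_def)
    then show ?thesis unfolding lipschitz_wrt_def by blast
  qed
  have H: "lipschitz_wrt (state_dist k) (state_cube k R) (\<lambda>x::(nat \<Rightarrow> real)^'n. h (x $ j) (x $ i) c)" for i
  proof -
    let ?K = "{..<k} <+> {..<k}"
    have "C_diff (Suc 0) ?K (\<lambda>z. h (z \<circ> Inl) (z \<circ> Inr) c)"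
      using adm c unfolding admissible_def smooth_map2_def smooth_map_def by blast
    from C_diff_lipschitz_on_cube[OF finite_Plus[OF finite_lessThan finite_lessThan] this, of R]
    obtain L where "L \<ge> 0" and L: "\<And>x y. \<lbrakk>x \<in> cube ?K R; y \<in> cube ?K R\<rbrakk> \<Longrightarrow>
        \<bar>h (x \<circ> Inl) (x \<circ> Inr) c - h (y \<circ> Inl) (y \<circ> Inr) c\<bar> \<le> L * (\<Sum>i\<in>?K. \<bar>x i - y i\<bar>)" by blast
    \<comment> \<open>The pair of cell states is encoded as \<open>case_sum (x $ j) (x $ i)\<close>.
      Its two halves each contribute at most \<open>state_dist k x y\<close>, whence the factor
      2.\<close>
    have "\<bar>h (x $ j) (x $ i) c - h (y $ j) (y $ i) c\<bar> \<le> (2 * L) * state_dist k x y"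
      if "x \<in> state_cube k R" "y \<in> state_cube k R" for x y :: "(nat \<Rightarrow> real)^'n"
    proof -
      have in_cube: "case_sum (z $ j) (z $ i) \<in> cube ?K R" if "z \<in> state_cube k R" for z :: "(nat \<Rightarrow> real)^'n"
        using that by (auto simp: state_cube_def cube_def rvec_def split: sum.splits)
      have "(\<Sum>l\<in>?K. \<bar>case_sum (x $ j) (x $ i) l - case_sum (y $ j) (y $ i) l\<bar>) \<le> 2 * state_dist k x y"
        using sum_cell_le_state_dist[of x j y k] sum_cell_le_state_dist[of x i y k]
        by (simp add: sum.Plus)
      from mult_left_mono[OF this \<open>L \<ge> 0\<close>] L[OF in_cube[OF that(1)] in_cube[OF that(2)]]
      show ?thesis by (simp add: case_sum_o_inj mult.left_commute mult.assoc)
    qed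
    then show ?thesis unfolding lipschitz_wrt_def by blast
  qed
  have "lipschitz_wrt (state_dist k) (state_cube k R)
      (\<lambda>x. g (x $ j) c + (\<Sum>i\<in>UNIV. W $ j $ i * h (x $ j) (x $ i) c))"
    by (intro lipschitz_wrt_add lipschitz_wrt_sum lipschitz_wrt_cmult G H)
  moreover have "(f x $ j) c = g (x $ j) c + (\<Sum>i\<in>UNIV. W $ j $ i * h (x $ j) (x $ i) c)"
    if "x \<in> state_cube k R" for x
    using adm that unfolding admissible_def by (auto simp: state_cube_def phase_space_def cube_def)
  ultimately show ?thesis unfolding lipschitz_wrt_def by simp
qed

section \<open>Differential equations\<close>

text \<open>The function \<open>u s * exp (- C * s)\<close> is nonincreasing and starts at
  0.\<close>

lemma gronwall_zero_right:
  fixes u :: "real \<Rightarrow> real"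
  assumes "0 \<le> t" and nonneg: "u t \<ge> 0" and "u 0 = 0"
    and d: "\<And>s. s \<in> {0..t} \<Longrightarrow> (u has_real_derivative u' s) (at s)"
    and le: "\<And>s. s \<in> {0..t} \<Longrightarrow> u' s \<le> C * u s"
  shows "u t = 0"
proof -
  have "u t * exp (- C * t) \<le> u 0 * exp (- C * 0)"
  proof (rule DERIV_nonpos_imp_nonincreasing[OF \<open>0 \<le> t\<close>])
    fix s assume s: "0 \<le> s" "s \<le> t"
    have "((\<lambda>s. u s * exp (- C * s)) has_real_derivative (u' s - C * u s) * exp (- C * s)) (at s)"
      using d[of s] s by (auto intro!: derivative_eq_intros simp: algebra_simps)
    moreover have "(u' s - C * u s) * exp (- C * s) \<le> 0"
      using le[of s] s by (intro mult_nonpos_nonneg) auto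
    ultimately show "\<exists>y. ((\<lambda>s. u s * exp (- C * s)) has_real_derivative y) (at s) \<and> y \<le> 0" by blast
  qed
  then show ?thesis using nonneg \<open>u 0 = 0\<close> by (simp add: mult_le_0_iff)
qed

text \<open>The bound on the absolute value of \<open>u'\<close> survives time reversal, so negative
  \<open>t\<close> reduces to the forward estimate for \<open>u (- s)\<close>. Both signs occur,
  since solutions live on open intervals around 0.\<close>

lemma gronwall_zero:
  fixes u :: "real \<Rightarrow> real"
  assumes nonneg: "u t \<ge> 0" and "u 0 = 0"
    and d: "\<And>s. s \<in> closed_segment 0 t \<Longrightarrow> (u has_real_derivative u' s) (at s)"
    and le: "\<And>s. s \<in> closed_segment 0 t \<Longrightarrow> \<bar>u' s\<bar> \<le> C * u s"
  shows "u t = 0"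
proof (cases "0 \<le> t")
  case True
  show ?thesis
  proof (rule gronwall_zero_right[OF True nonneg \<open>u 0 = 0\<close>])
    fix s assume "s \<in> {0..t}"
    then have s: "s \<in> closed_segment 0 t" by (simp add: closed_segment_eq_real_ivl)
    show "(u has_real_derivative u' s) (at s)" by (rule d[OF s])
    show "u' s \<le> C * u s" using le[OF s] by simp
  qed
next
  case False
  have "u (- (- t)) = 0"
  proof (rule gronwall_zero_right[where u = "\<lambda>s. u (- s)" and u' = "\<lambda>s. - u' (- s)" and C = C])
    fix s assume "s \<in> {0..- t}"
    then have s: "- s \<in> closed_segment 0 t" using False by (simp add: closed_segment_eq_real_ivl)
    show "((\<lambda>s. u (- s)) has_real_derivative - u' (- s)) (at s)"
      using d[OF s] by (simp add: DERIV_mirror)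
    show "- u' (- s) \<le> C * u (- s)" using le[OF s] by simp
  qed (use False assms in auto)
  then show ?thesis by simp
qed

text \<open>The scalar estimate is applied to the sum of squares \<open>u\<close>, which is
  differentiable, unlike the sum of absolute values in the hypothesis.\<close>

lemma gronwall_system_zero:
  fixes w :: "real \<Rightarrow> 'p \<Rightarrow> real"
  assumes "finite P" and w0: "\<And>p. p \<in> P \<Longrightarrow> w 0 p = 0"
    and d: "\<And>s p. \<lbrakk>s \<in> closed_segment 0 t; p \<in> P\<rbrakk> \<Longrightarrow> ((\<lambda>s. w s p) has_real_derivative w' s p) (at s)"
    and le: "\<And>s p. \<lbrakk>s \<in> closed_segment 0 t; p \<in> P\<rbrakk> \<Longrightarrow> \<bar>w' s p\<bar> \<le> L p * (\<Sum>q\<in>P. \<bar>w s q\<bar>)"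
    and p: "p \<in> P"
  shows "w t p = 0"
proof -
  define M where "M = (\<Sum>p\<in>P. \<bar>L p\<bar>)"
  define u where "u s = (\<Sum>p\<in>P. (w s p)\<^sup>2)" for s
  have "u t = 0"
  proof (rule gronwall_zero[where u = u])
    show "u t \<ge> 0" by (simp add: u_def sum_nonneg)
    show "u 0 = 0" by (simp add: u_def w0)
    fix s assume s: "s \<in> closed_segment 0 t"
    show "(u has_real_derivative (\<Sum>p\<in>P. 2 * w s p * w' s p)) (at s)"
      unfolding u_def using d[OF s] by (auto intro!: derivative_eq_intros sum.cong)
    let ?D = "\<Sum>q\<in>P. \<bar>w s q\<bar>"
    have D0: "?D \<ge> 0" by (simp add: sum_nonneg)
    have "\<bar>\<Sum>p\<in>P. 2 * w s p * w' s p\<bar> \<le> (\<Sum>p\<in>P. \<bar>2 * w s p * w' s p\<bar>)" by (rule sum_abs)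
    also have "\<dots> \<le> (\<Sum>p\<in>P. \<bar>w s p\<bar> * (2 * M * ?D))"
    proof (rule sum_mono)
      fix p assume p: "p \<in> P"
      have "L p \<le> M"
        using member_le_sum[OF p, of "\<lambda>p. \<bar>L p\<bar>"] \<open>finite P\<close> by (simp add: M_def)
      then have "\<bar>w' s p\<bar> \<le> M * ?D"
        using le[OF s p] mult_right_mono[OF _ D0] by (blast intro: order_trans)
      from mult_left_mono[OF this abs_ge_zero[of "w s p"]]
      show "\<bar>2 * w s p * w' s p\<bar> \<le> \<bar>w s p\<bar> * (2 * M * ?D)" by (simp add: abs_mult)
    qed
    also have "\<dots> = (2 * M) * ?D\<^sup>2"
      by (simp add: power2_eq_square flip: sum_distrib_right)
    \<comment> \<open>Cauchy-Schwarz turns the squared l1 norm into \<open>card P\<close> times the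
      sum of squares.\<close>
    also have "\<dots> \<le> (2 * M) * (u s * card P)"
      using sum_squared_le_sum_of_squares[of "\<lambda>q. \<bar>w s q\<bar>" P]
      by (intro mult_left_mono) (auto simp: u_def M_def sum_nonneg)
    also have "\<dots> = (2 * M * card P) * u s" by simp
    finally show "\<bar>\<Sum>p\<in>P. 2 * w s p * w' s p\<bar> \<le> (2 * M * card P) * u s" .
  qed
  then show ?thesis using \<open>finite P\<close> p by (simp add: u_def sum_nonneg_eq_0_iff)
qed

text \<open>The solution is the matrix exponential of \<open>t\<close> times \<open>A\<close>
  applied to \<open>v\<close>, written componentwise as a power series in \<open>t\<close> with
  coefficients \<open>a i m\<close>.\<close>

lemma linear_ode_solution_exists:
  fixes A :: "real^'n^'n" and v :: "real^'n"
  shows "\<exists>y. y 0 = v \<and> (\<forall>t i. ((\<lambda>s. y s $ i) has_real_derivative (A *v y t) $ i) (at t))"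
proof -
  define a where "a i m = (((*v) A ^^ m) v) $ i / fact m" for i m
  obtain K where K: "K > 0" "\<And>x. norm (A *v x) \<le> norm x * K"
    using bounded_linear.pos_bounded[OF matrix_vector_mul_bounded_linear[of A]] by blast
  have nm: "norm (((*v) A ^^ m) v) \<le> norm v * K ^ m" for m
  proof (induction m)
    case (Suc m)
    have "norm (((*v) A ^^ Suc m) v) \<le> norm (((*v) A ^^ m) v) * K" by (simp add: K(2))
    also have "\<dots> \<le> norm v * K ^ m * K" using Suc K(1) by (intro mult_right_mono) auto
    finally show ?case by (simp add: mult_ac)
  qed simp
  have summable: "summable (\<lambda>m. a i m * t ^ m)" for i t
  \<comment> \<open>The comparison series is \<open>norm v\<close> times the exponential series at
    \<open>K * \<bar>t\<bar>\<close>.\<close>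
  proof (rule summable_comparison_test')
    show "summable (\<lambda>m. norm v * (inverse (fact m) * (K * \<bar>t\<bar>) ^ m))"
      by (intro summable_mult summable_exp)
    fix m :: nat
    have "\<bar>(((*v) A ^^ m) v) $ i\<bar> \<le> norm v * K ^ m"
      using component_le_norm_cart nm order_trans by blast
    then have "\<bar>(((*v) A ^^ m) v) $ i\<bar> * (inverse (fact m) * \<bar>t\<bar> ^ m)
        \<le> (norm v * K ^ m) * (inverse (fact m) * \<bar>t\<bar> ^ m)"
      by (intro mult_right_mono) auto
    then show "norm (a i m * t ^ m) \<le> norm v * (inverse (fact m) * (K * \<bar>t\<bar>) ^ m)"
      by (simp add: a_def abs_mult power_abs power_mult_distrib field_simps)
  qed
  define y where "y t = (\<chi> i. \<Sum>m. a i m * t ^ m)" for t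
  have "((\<lambda>s. y s $ i) has_real_derivative (A *v y t) $ i) (at t)" for t i
  proof -
    \<comment> \<open>The coefficients of the termwise derivative are
      \<open>(m + 1) * a i (m + 1)\<close>. The factor \<open>m + 1\<close> cancels in the
      factorial, which leaves one more application of \<open>A\<close>.\<close>
    have "diffs (a i) m = (\<Sum>j\<in>UNIV. A $ i $ j * a j m)" for m
    proof -
      have "diffs (a i) m = (A *v ((*v) A ^^ m) v) $ i / fact m"
        by (simp add: diffs_def a_def del: of_nat_Suc)
      also have "\<dots> = (\<Sum>j\<in>UNIV. A $ i $ j * a j m)"
        by (simp add: matrix_vector_mult_def a_def sum_divide_distrib)
      finally show ?thesis .
    qed
    then have "(\<Sum>m. diffs (a i) m * t ^ m) = (\<Sum>m. \<Sum>j\<in>UNIV. A $ i $ j * (a j m * t ^ m))"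
      by (simp add: sum_distrib_right mult.assoc)
    also have "\<dots> = (\<Sum>j\<in>UNIV. \<Sum>m. A $ i $ j * (a j m * t ^ m))"
      by (intro suminf_sum summable_mult summable)
    also have "\<dots> = (\<Sum>j\<in>UNIV. A $ i $ j * (\<Sum>m. a j m * t ^ m))"
      by (intro sum.cong refl suminf_mult summable)
    also have "\<dots> = (A *v y t) $ i" by (simp add: matrix_vector_mult_def y_def)
    finally show ?thesis
      using termdiffs_strong_converges_everywhere[of "a i" t, OF summable] by (simp add: y_def)
  qed
  moreover have "y 0 = v" by (simp add: y_def vec_eq_iff) (simp add: a_def)
  ultimately show ?thesis by blast
qed

section \<open>Invariance of polydiagonals\<close>

text \<open>A representative \<open>r i\<close> of the part of each cell \<open>i\<close> yields the
  projection onto the polydiagonal that gives cell \<open>i\<close> the state of cell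
  \<open>r i\<close>.\<close>

lemma partition_representatives:
  assumes "partition_on UNIV \<P>"
  shows "\<exists>r. (\<forall>i. \<exists>A\<in>\<P>. i \<in> A \<and> r i \<in> A) \<and> (\<forall>A\<in>\<P>. \<forall>i\<in>A. \<forall>j\<in>A. r i = r j)"
proof -
  define part where "part i = (THE A. A \<in> \<P> \<and> i \<in> A)" for i
  have ex1: "\<exists>!A. A \<in> \<P> \<and> i \<in> A" for i
  proof -
    obtain A where "A \<in> \<P>" "i \<in> A"
      using assms unfolding partition_on_def by blast
    then show ?thesis
      using assms by (metis disjoint_iff disjointD partition_onD2)
  qed
  then have part: "part i \<in> \<P> \<and> i \<in> part i" for i
    unfolding part_def by (rule theI')
  have part_eq: "part i = A" if "A \<in> \<P>" "i \<in> A" for i A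
    using ex1[of i] part[of i] that by blast
  \<comment> \<open>The choice depends on \<open>i\<close> only through \<open>part i\<close>, so it
    is constant on parts.\<close>
  define r where "r i = (SOME j. j \<in> part i)" for i
  have "r i \<in> part i" for i
    unfolding r_def by (rule someI[of _ i]) (simp add: part)
  then have "\<exists>A\<in>\<P>. i \<in> A \<and> r i \<in> A" for i
    using part[of i] by (intro bexI[of _ "part i"]) auto
  moreover have "r i = r j" if "A \<in> \<P>" "i \<in> A" "j \<in> A" for A i j
    using that by (simp add: r_def part_eq)
  ultimately have "(\<forall>i. \<exists>A\<in>\<P>. i \<in> A \<and> r i \<in> A) \<and> (\<forall>A\<in>\<P>. \<forall>i\<in>A. \<forall>j\<in>A. r i = r j)"
    by (intro conjI allI ballI)
  then show ?thesis by (rule exI[of _ r])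
qed

text \<open>Exo-balance concerns scalar states only. It is applied for each component
  \<open>c\<close> separately, to the values of the coupling function at \<open>x\<close>.\<close>

lemma exo_balanced_tangent:
  assumes E: "exo_balanced W \<P>" and adm: "admissible k W g h f"
    and h0: "\<And>a. a \<in> rvec {..<k} \<Longrightarrow> h a a = (\<lambda>_. 0)"
    and x: "x \<in> polydiagonal (rvec {..<k}) \<P>" and A: "A \<in> \<P>" "i \<in> A" "j \<in> A"
  shows "f x $ i = f x $ j"
proof -
  have xp: "x \<in> phase_space k" using x by (simp add: polydiagonal_def phase_space_def)
  have xij: "x $ i = x $ j" using polydiagonalD[OF x A] .
  have "(\<Sum>l\<in>UNIV. W $ i $ l * h (x $ i) (x $ l) c) = (\<Sum>l\<in>UNIV. W $ j $ l * h (x $ i) (x $ l) c)" for c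
  proof -
    \<comment> \<open>The first argument is frozen at \<open>x $ i\<close>, which equals
      \<open>x $ j\<close>, so one vector serves both rows. As \<open>y\<close> vanishes at
      \<open>i\<close> and \<open>j\<close>, these rows of the Laplacian give minus the coupling
      sums.\<close>
    define y :: "real^'a" where "y = (\<chi> l. h (x $ i) (x $ l) c)"
    have y0: "y $ i = 0" "y $ j = 0"
      using h0[of "x $ i"] xp xij by (auto simp: y_def phase_space_def)
    have "y $ l = y $ m" if "B \<in> \<P>" "l \<in> B" "m \<in> B" for B l m
      using polydiagonalD[OF x that] by (simp add: y_def)
    then have "y \<in> polydiagonal UNIV \<P>"
      unfolding polydiagonal_def by blast
    then have "laplacian W *v y \<in> polydiagonal UNIV \<P>"
      using E unfolding exo_balanced_def by blast
    from polydiagonalD[OF this A] show ?thesis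
      by (simp add: laplacian_mult_nth y0 sum_negf) (simp add: y_def)
  qed
  then show ?thesis using adm xp xij unfolding admissible_def by simp
qed

text \<open>Components of a solution are continuous, hence bounded on a compact time segment. This
  provides one cube, and so one set of Lipschitz constants, for the whole segment.\<close>

lemma solution_bounded:
  assumes sol: "solution_on k f T x" and seg: "closed_segment 0 t \<subseteq> T"
  obtains R where "\<And>s. s \<in> closed_segment 0 t \<Longrightarrow> x s \<in> state_cube k R"
proof -
  have "\<exists>B. \<forall>s\<in>closed_segment 0 t. \<bar>(x s $ i) c\<bar> \<le> B" if "c < k" for i c
  proof -
    have "continuous_on (closed_segment 0 t) (\<lambda>s. (x s $ i) c)"
    proof (rule continuous_at_imp_continuous_on, rule ballI)
      fix s assume "s \<in> closed_segment 0 t"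
      then show "isCont (\<lambda>s. (x s $ i) c) s"
        using sol seg that unfolding solution_on_def by (blast intro: DERIV_isCont)
    qed
    then have "compact ((\<lambda>s. (x s $ i) c) ` closed_segment 0 t)"
      by (rule compact_continuous_image) (rule compact_segment)
    then have "bounded ((\<lambda>s. (x s $ i) c) ` closed_segment 0 t)" by (rule compact_imp_bounded)
    then show ?thesis by (simp add: bounded_iff)
  qed
  then have "\<forall>i c. \<exists>B. c < k \<longrightarrow> (\<forall>s\<in>closed_segment 0 t. \<bar>(x s $ i) c\<bar> \<le> B)" by blast
  then obtain B where B: "\<And>i c s. \<lbrakk>c < k; s \<in> closed_segment 0 t\<rbrakk> \<Longrightarrow> \<bar>(x s $ i) c\<bar> \<le> B i c"
    by metis
  define R where "R = (\<Sum>(i, c)\<in>UNIV \<times> {..<k}. \<bar>B i c\<bar>)"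
  have "B i c \<le> R" if "c < k" for i c
    using member_le_sum[of "(i, c)" "UNIV \<times> {..<k}" "\<lambda>(i, c). \<bar>B i c\<bar>"] that
    by (auto simp: R_def)
  then have "\<bar>(x s $ i) c\<bar> \<le> R" if "c < k" "s \<in> closed_segment 0 t" for s i c
    using B[OF that] that(1) order_trans by blast
  moreover have "x s \<in> phase_space k" if "s \<in> closed_segment 0 t" for s
    using sol seg that unfolding solution_on_def by blast
  ultimately show thesis
    by (intro that[of R]) (simp add: state_cube_def cube_def phase_space_def)
qed

text \<open>The deviation \<open>w\<close> of the solution from its projection has derivative
  \<open>F\<close> along the solution. Since \<open>F\<close> vanishes on the polydiagonal, its
  Lipschitz bound controls it by the distance to the projection, which is the l1 norm of
  \<open>w\<close>; then \<open>gronwall_system_zero\<close> applies.\<close>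

lemma exo_balanced_imp_flow_invariant:
  fixes W :: "'n::finite network"
  assumes P: "partition_on UNIV \<P>" and E: "exo_balanced W \<P>" and f: "f \<in> systems_I0 k W"
  shows "flow_invariant k f (polydiagonal (rvec {..<k}) \<P>)"
  unfolding flow_invariant_def
proof (intro allI impI ballI)
  fix T x t
  assume A: "open T \<and> is_interval T \<and> 0 \<in> T \<and> solution_on k f T x \<and> x 0 \<in> polydiagonal (rvec {..<k}) \<P>"
    and t: "t \<in> T"
  obtain g h where adm: "admissible k W g h f" and h0: "\<And>a. a \<in> rvec {..<k} \<Longrightarrow> h a a = (\<lambda>_. 0)"
    using f unfolding systems_I0_def by blast
  obtain r where r: "\<And>i. \<exists>A\<in>\<P>. i \<in> A \<and> r i \<in> A"
    and r_eq: "\<And>A i j. \<lbrakk>A \<in> \<P>; i \<in> A; j \<in> A\<rbrakk> \<Longrightarrow> r i = r j"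
    using partition_representatives[OF P] by blast
  have seg: "closed_segment 0 t \<subseteq> T"
    using A t by (intro closed_segment_subset) (auto intro: is_interval_convex)
  obtain R where R: "\<And>s. s \<in> closed_segment 0 t \<Longrightarrow> x s \<in> state_cube k R"
    using A by (auto intro: solution_bounded[OF _ seg])
  let ?proj = "\<lambda>z::(nat \<Rightarrow> real)^'n. \<chi> i. z $ r i"
  \<comment> \<open>The difference is written with \<open>(- 1) *\<close> to fit the closure rules
    for sums and scalar multiples.\<close>
  define F where "F p z = (f z $ fst p) (snd p) + (- 1) * (f z $ r (fst p)) (snd p)" for p z
  have "lipschitz_wrt (state_dist k) (state_cube k R) (F p)" if "p \<in> UNIV \<times> {..<k}" for p
    unfolding F_def using that
    by (intro lipschitz_wrt_add lipschitz_wrt_cmult admissible_lipschitz[OF adm]) auto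
  then have "\<forall>p\<in>UNIV \<times> {..<k}. \<exists>l. \<forall>z\<in>state_cube k R. \<forall>z'\<in>state_cube k R.
      \<bar>F p z - F p z'\<bar> \<le> l * state_dist k z z'"
    unfolding lipschitz_wrt_def by blast
  from bchoice[OF this] obtain L where L: "\<forall>p\<in>UNIV \<times> {..<k}. \<forall>z\<in>state_cube k R. \<forall>z'\<in>state_cube k R.
      \<bar>F p z - F p z'\<bar> \<le> L p * state_dist k z z'" ..
  have zero: "(x t $ i) c - (x t $ r i) c = 0" if "c < k" for i c
  proof -
    define w where "w s = (\<lambda>(i, c). (x s $ i) c - (x s $ r i) c)" for s
    have "w t (i, c) = 0"
    proof (rule gronwall_system_zero[where P = "UNIV \<times> {..<k}" and w = w and w' = "\<lambda>s p. F p (x s)" and L = L])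
      show "w 0 p = 0" for p
      proof -
        obtain A where "A \<in> \<P>" "fst p \<in> A" "r (fst p) \<in> A" using r by blast
        then have "x 0 $ fst p = x 0 $ r (fst p)" using A polydiagonalD[of "x 0"] by blast
        then show ?thesis by (simp add: w_def case_prod_unfold)
      qed
      fix s p assume s: "s \<in> closed_segment 0 t" and p: "p \<in> (UNIV \<times> {..<k} :: ('n \<times> nat) set)"
      obtain i c where ic: "p = (i, c)" "c < k" using p by auto
      have "((\<lambda>s. (x s $ i) c) has_real_derivative (f (x s) $ i) c) (at s)" for i
        using A s seg ic(2) unfolding solution_on_def by blast
      from DERIV_diff[OF this[of i] this[of "r i"]]
      show "((\<lambda>s. w s p) has_real_derivative F p (x s)) (at s)"
        by (simp add: w_def F_def ic)
      \<comment> \<open>The entries of the projection are among the entries of \<open>x s\<close>,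
        so the same cube contains it.\<close>
      have proj_cube: "?proj (x s) \<in> state_cube k R" using R[OF s] by (simp add: state_cube_def)
      have "?proj (x s) \<in> polydiagonal (rvec {..<k}) \<P>"
        using R[OF s] by (auto simp: polydiagonal_def state_cube_def cube_def dest: r_eq)
      \<comment> \<open>Tangency at the projected state: \<open>i\<close> and \<open>r i\<close> lie
        in a common part.\<close>
      then have "F p (?proj (x s)) = 0"
        using exo_balanced_tangent[OF E adm h0, of "?proj (x s)" _ i "r i"] r[of i] by (auto simp: F_def ic)
      moreover have "state_dist k (x s) (?proj (x s)) = (\<Sum>q\<in>UNIV \<times> {..<k}. \<bar>w s q\<bar>)"
        by (simp add: state_dist_def w_def case_prod_unfold)
      moreover have "\<bar>F p (x s) - F p (?proj (x s))\<bar> \<le> L p * state_dist k (x s) (?proj (x s))"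
        using L p R[OF s] proj_cube by blast
      ultimately show "\<bar>F p (x s)\<bar> \<le> L p * (\<Sum>q\<in>UNIV \<times> {..<k}. \<bar>w s q\<bar>)" by simp
    qed (use that in auto)
    then show ?thesis by (simp add: w_def)
  qed
  have xt: "x t $ i \<in> rvec {..<k}" for i
    using A t unfolding solution_on_def phase_space_def by blast
  have "x t $ i = x t $ r i" for i
  proof
    show "(x t $ i) c = (x t $ r i) c" for c
      using zero[of c i] xt[of i] xt[of "r i"] by (cases "c < k") (auto simp: rvec_def)
  qed
  then have "x t $ i = x t $ j" if "A \<in> \<P>" "i \<in> A" "j \<in> A" for A i j
    using r_eq[OF that] by metis
  then show "x t \<in> polydiagonal (rvec {..<k}) \<P>"
    using xt unfolding polydiagonal_def by blast
qed

section \<open>The converse, by a test system with linear coupling\<close>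

lemma C_diff_const: "C_diff m I (\<lambda>x. a)"
  by (induction m arbitrary: a) (auto intro!: exI[of _ "\<lambda>x. 0"])

text \<open>All first partial derivatives are constants 1, -1 or 0. This gives smoothness of the
  test coupling, with \<open>p\<close> and \<open>q\<close> the two copies of the same
  component.\<close>

lemma C_diff_coordinate_diff:
  assumes "p \<noteq> q"
  shows "C_diff m I (\<lambda>x. x q - x p)"
proof -
  have cont: "continuous_on (rvec I) (\<lambda>x. x q - x p)"
    by (intro continuous_intros continuous_on_subset[OF continuous_on_product_coordinates]) auto
  show ?thesis
  proof (cases m)
    case (Suc m')
    have "((\<lambda>s. (x(i := s)) q - (x(i := s)) p) has_real_derivative
        (if i = q then 1 else if i = p then -1 else 0)) (at (x i))" for x i
      using assms by (auto intro!: derivative_eq_intros)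
    then show ?thesis using cont Suc C_diff_const by auto blast
  qed (use cont in simp)
qed

text \<open>Cell dimension 1 suffices. A solution starting at \<open>v\<close> in the polydiagonal
  stays there, so its entries at two cells of one part agree at all times, and so do their
  derivatives at time 0, which are the entries of \<open>- laplacian W *v v\<close>.\<close>

lemma flow_invariant_imp_exo_balanced:
  fixes W :: "'n::finite network"
  assumes inv: "\<And>f. f \<in> systems_I0 1 W \<Longrightarrow> flow_invariant 1 f (polydiagonal (rvec {..<1}) \<P>)"
  shows "exo_balanced W \<P>"
proof -
  define g :: "(nat \<Rightarrow> real) \<Rightarrow> nat \<Rightarrow> real" where "g = (\<lambda>_ _. 0)"
  define h :: "(nat \<Rightarrow> real) \<Rightarrow> (nat \<Rightarrow> real) \<Rightarrow> nat \<Rightarrow> real" where "h = (\<lambda>a b c. b c - a c)"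
  define f :: "(nat \<Rightarrow> real)^'n \<Rightarrow> (nat \<Rightarrow> real)^'n" where
    "f x = (\<chi> j. (\<lambda>c. g (x $ j) c + (\<Sum>i\<in>UNIV. W $ j $ i * h (x $ j) (x $ i) c)))" for x
  have "smooth_map {..<1} {..<1} g"
    by (simp add: smooth_map_def g_def C_diff_const rvec_def)
  moreover have "smooth_map2 1 h"
    by (auto simp: smooth_map2_def smooth_map_def h_def rvec_def Plus_def image_iff
      intro: C_diff_coordinate_diff)
  ultimately have "f \<in> systems_I0 1 W"
    unfolding systems_I0_def admissible_def by (auto simp: f_def h_def intro!: exI[of _ g] exI[of _ h])
  then have finv: "flow_invariant 1 f (polydiagonal (rvec {..<1}) \<P>)" by (rule inv)
  have "(laplacian W *v v) $ i = (laplacian W *v v) $ j"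
    if v: "v \<in> polydiagonal UNIV \<P>" and A: "A \<in> \<P>" "i \<in> A" "j \<in> A" for v A i j
  proof -
    obtain y where y0: "y 0 = v"
      and y: "\<And>t i. ((\<lambda>s. y s $ i) has_real_derivative (- laplacian W *v y t) $ i) (at t)"
      using linear_ode_solution_exists by blast
    \<comment> \<open>The scalar solution is placed in component 0, the only one of
      \<open>rvec {..<1}\<close>; the other components must be 0.\<close>
    define x :: "real \<Rightarrow> (nat \<Rightarrow> real)^'n" where "x t = (\<chi> i. (\<lambda>c. if c = 0 then y t $ i else 0))" for t
    have fx: "(f (x t) $ i) 0 = (- laplacian W *v y t) $ i" for t i
    proof -
      have "(- laplacian W *v y t) $ i = - (laplacian W *v y t) $ i"
        by (simp add: matrix_vector_mult_def sum_negf)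
      also have "\<dots> = (f (x t) $ i) 0"
        unfolding laplacian_mult_nth by (simp add: f_def x_def g_def h_def flip: sum_negf mult_minus_right)
      finally show ?thesis by simp
    qed
    have "solution_on 1 f UNIV x"
      using y fx by (auto simp: solution_on_def phase_space_def rvec_def x_def)
    moreover have "x 0 \<in> polydiagonal (rvec {..<1}) \<P>"
    proof -
      have "x 0 $ l = x 0 $ m" if "B \<in> \<P>" "l \<in> B" "m \<in> B" for B l m
        using polydiagonalD[OF v that] by (simp add: x_def y0 cong: if_cong)
      moreover have "x 0 $ l \<in> rvec {..<1}" for l
        by (simp add: x_def rvec_def)
      ultimately show ?thesis unfolding polydiagonal_def by blast
    qed
    ultimately have "x t \<in> polydiagonal (rvec {..<1}) \<P>" for t
      using finv unfolding flow_invariant_def by (auto simp: is_interval_univ)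
    from polydiagonalD[OF this A] have "x t $ i = x t $ j" for t .
    from fun_cong[OF this, of _ 0] have "y t $ i = y t $ j" for t
      by (simp add: x_def)
    \<comment> \<open>Entries \<open>i\<close> and \<open>j\<close> of \<open>y\<close> are the same
      function of time, so uniqueness of the derivative at 0 applies.\<close>
    then have "(- laplacian W *v v) $ i = (- laplacian W *v v) $ j"
      using y[of i 0] y[of j 0] DERIV_unique y0 by auto
    then show ?thesis by (simp add: matrix_vector_mult_def sum_negf)
  qed
  then show ?thesis
    unfolding exo_balanced_def by (subst (2) polydiagonal_def) blast
qed

theorem proposition7p1:
  fixes W :: "'n::finite network" and \<P> :: "'n set set"
  assumes "partition_on UNIV \<P>"
  shows "exo_balanced W \<P> \<longleftrightarrow>
    (\<forall>k\<ge>1. \<forall>f\<in>systems_I0 k W. flow_invariant k f (polydiagonal (rvec {..<k}) \<P>))"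
  using exo_balanced_imp_flow_invariant[OF assms] flow_invariant_imp_exo_balanced by blast

end
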